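(* Let $F=F(d,N,\mathcal{I})$ be a sponge-like set in $\mathbb{R}^d$, with geometric approximations $F_k$, $k\ge0$. Then $F$ is connected if and only if $F_{C(d)}$ is connected, where $C(d):=c(d!\,2^{d}+2,\,d)$ and $$c(n,d):=(d-1)n^2+\frac{n^2+n}{2}+d-1.$$
   Context: Let $d\ge1$ and $N\ge2$ be integers. $\mathcal{O}_d$ denotes the group of symmetries of the cube $[0,1]^d$, i.e. all isometries of $\mathbb{R}^d$ mapping $[0,1]^d$ onto itself (orientation preserving or reversing). Let $\mathcal{I}\subset\{0,1,\ldots,N-1\}^d$ with $1<|\mathcal{I}|<N^d$, and for each $i\in\mathcal{I}$ let $O_i\in\mathcal{O}_d$ and $\varphi_i(x)=\frac1N(O_i(x)+i)$, $x\in\mathbb{R}^d$. The sponge-like set $F=F(d,N,\mathcal{I})$ is the unique non-empty compact set with $F=\bigcup_{i\in\mathcal{I}}\varphi_i(F)$. Its geometric approximations are $F_0:=[0,1]^d$ and $F_k:=\bigcup_{i\in\mathcal{I}}\varphi_i(F_{k-1})$ for $k\ge1$. *)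

theory Defs
  imports "HOL-Analysis.Analysis"
begin

abbreviation unit_cube :: "(real ^ 'd) set"
  where "unit_cube \<equiv> cbox 0 1"

text \<open>Distance-preserving self-maps of Euclidean space are automatically bijective, so these
  are exactly the symmetries (orientation preserving or reversing) of the unit cube.\<close>

definition cube_symmetries :: "(real ^ 'd \<Rightarrow> real ^ 'd) set"
  where "cube_symmetries =
    {g. (\<forall>x y. dist (g x) (g y) = dist x y) \<and> g ` unit_cube = unit_cube}"

definition sponge_map ::
    "nat \<Rightarrow> (nat ^ 'd \<Rightarrow> real ^ 'd \<Rightarrow> real ^ 'd) \<Rightarrow> nat ^ 'd \<Rightarrow> real ^ 'd \<Rightarrow> real ^ 'd"
  where "sponge_map N Q i x = (1 / real N) *\<^sub>R (Q i x + (\<chi> j. real (i $ j)))"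

definition sponge_step ::
    "nat \<Rightarrow> (nat ^ 'd) set \<Rightarrow> (nat ^ 'd \<Rightarrow> real ^ 'd \<Rightarrow> real ^ 'd) \<Rightarrow> (real ^ 'd) set \<Rightarrow> (real ^ 'd) set"
  where "sponge_step N I Q A = (\<Union>i\<in>I. sponge_map N Q i ` A)"

text \<open>Well defined whenever \<open>N \<ge> 2\<close>, \<open>I\<close> is a finite non-empty set of digits and every
  \<open>Q i\<close> is a symmetry of the cube; see \<open>sponge_ex1\<close> below.\<close>

definition sponge ::
    "nat \<Rightarrow> (nat ^ 'd) set \<Rightarrow> (nat ^ 'd \<Rightarrow> real ^ 'd \<Rightarrow> real ^ 'd) \<Rightarrow> (real ^ 'd) set"
  where "sponge N I Q = (THE F. F \<noteq> {} \<and> compact F \<and> F = sponge_step N I Q F)"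

primrec sponge_approx ::
    "nat \<Rightarrow> (nat ^ 'd) set \<Rightarrow> (nat ^ 'd \<Rightarrow> real ^ 'd \<Rightarrow> real ^ 'd) \<Rightarrow> nat \<Rightarrow> (real ^ 'd) set"
  where
    "sponge_approx N I Q 0 = unit_cube"
  | "sponge_approx N I Q (Suc k) = sponge_step N I Q (sponge_approx N I Q k)"

text \<open>The division by 2 is exact, and the subtractions do not truncate for \<open>d \<ge> 1\<close>.\<close>

definition sponge_c :: "nat \<Rightarrow> nat \<Rightarrow> nat"
  where "sponge_c n d = (d - 1) * n\<^sup>2 + (n\<^sup>2 + n) div 2 + (d - 1)"

definition sponge_C :: "nat \<Rightarrow> nat"
  where "sponge_C d = sponge_c (fact d * 2 ^ d + 2) d"

lemma dist_sponge_map: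
  assumes "Q i \<in> cube_symmetries"
  shows "dist (sponge_map N Q i x) (sponge_map N Q i y) = dist x y / real N"
proof -
  have "dist (sponge_map N Q i x) (sponge_map N Q i y)
      = norm ((1 / real N) *\<^sub>R (Q i x - Q i y))"
    by (simp add: sponge_map_def dist_norm scaleR_diff_right[symmetric] del: scaleR_diff_right)
  also have "\<dots> = dist (Q i x) (Q i y) / real N"
    by (simp add: dist_norm)
  also have "dist (Q i x) (Q i y) = dist x y"
    using assms by (simp add: cube_symmetries_def)
  finally show ?thesis .
qed

lemma continuous_on_sponge_map:
  assumes "Q i \<in> cube_symmetries" "N \<ge> 1"
  shows "continuous_on A (sponge_map N Q i)"
  unfolding continuous_on_iff
proof (intro ballI allI impI)
  fix x e :: real and a assume "a \<in> A" "(0::real) < e"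
  have "dist (sponge_map N Q i y) (sponge_map N Q i a) \<le> dist y a" for y
    using assms(2) by (simp add: dist_sponge_map[where Q=Q and i=i, OF assms(1)] divide_le_eq mult_le_cancel_left1)
  then show "\<exists>d>0. \<forall>y\<in>A. dist y a < d \<longrightarrow>
      dist (sponge_map N Q i y) (sponge_map N Q i a) < e"
    using \<open>0 < e\<close> by (meson le_less_trans)
qed

lemma inj_sponge_map:
  assumes "Q i \<in> cube_symmetries" "N \<ge> 1"
  shows "inj (sponge_map N Q i)"
proof (rule injI)
  fix x y assume "sponge_map N Q i x = sponge_map N Q i y"
  then have "dist x y / real N = 0"
    using dist_sponge_map[where Q=Q and i=i, OF assms(1), of N x y] by simp
  then show "x = y" using assms(2) by simp
qed

lemma sponge_step_mono: "A \<subseteq> B \<Longrightarrow> sponge_step N I Q A \<subseteq> sponge_step N I Q B"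
  unfolding sponge_step_def by blast

lemma sponge_approx_Suc_subset:
  assumes "N \<ge> 1" "I \<subseteq> {i. \<forall>j. i $ j < N}" "\<And>i. i \<in> I \<Longrightarrow> Q i \<in> cube_symmetries"
  shows "sponge_approx N I Q (Suc k) \<subseteq> sponge_approx N I Q k"
proof (induction k)
  case 0
  have "sponge_map N Q i x \<in> unit_cube" if i: "i \<in> I" and x: "x \<in> unit_cube" for i x
  proof -
    have "Q i x \<in> unit_cube"
      using assms(3)[OF i] x unfolding cube_symmetries_def by blast
    then have b: "0 \<le> Q i x $ j \<and> Q i x $ j \<le> 1" for j
      by (simp add: mem_box_cart)
    have "real (i $ j) + 1 \<le> real N" for j
      using assms(2) i by (metis (mono_tags, lifting) Suc_eq_plus1 Suc_leI mem_Collect_eq of_nat_Suc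
          of_nat_le_iff subsetD add.commute)
    then have "0 \<le> Q i x $ j + real (i $ j) \<and> Q i x $ j + real (i $ j) \<le> real N" for j
      using b[of j] by (smt (verit) of_nat_0_le_iff)
    then show ?thesis
      using assms(1) by (simp add: mem_box_cart sponge_map_def divide_le_eq)
  qed
  then show ?case by (auto simp: sponge_step_def)
next
  case (Suc k)
  then show ?case using sponge_step_mono[OF Suc] by simp
qed

lemma sponge_fixpoint_le:
  assumes N: "N \<ge> 2" and Q: "\<And>i. i \<in> I \<Longrightarrow> Q i \<in> cube_symmetries"
    and F: "F \<noteq> {}" "compact F" "F = sponge_step N I Q F"
    and G: "G \<noteq> {}" "compact G" "G = sponge_step N I Q G"
  shows "F \<subseteq> G"
proof -
  obtain x where x: "x \<in> F" "\<And>y. y \<in> F \<Longrightarrow> infdist y G \<le> infdist x G"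
    using continuous_attains_sup[OF F(2,1), of "\<lambda>x. infdist x G"]
      continuous_on_infdist[OF continuous_on_id, of F G] by blast
  obtain i y where i: "i \<in> I" and y: "y \<in> F" "x = sponge_map N Q i y"
    using x(1) F(3) unfolding sponge_step_def by blast
  obtain z where z: "z \<in> G" "infdist y G = dist y z"
    using infdist_attains_inf[OF compact_imp_closed[OF G(2)] G(1)] by metis
  have "sponge_map N Q i z \<in> G"
    using G(3) z(1) i unfolding sponge_step_def by blast
  then have "infdist x G \<le> dist x (sponge_map N Q i z)" by (rule infdist_le)
  also have "\<dots> = infdist y G / real N"
    using dist_sponge_map[where Q=Q and i=i, OF Q[OF i]] y(2) z(2) by metis
  also have "\<dots> \<le> infdist x G / 2"
    using x(2)[OF y(1)] N infdist_nonneg[of y G] by (intro frac_le) auto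
  finally have "infdist x G \<le> 0" by simp
  then have "infdist y G = 0" if "y \<in> F" for y
    using x(2)[OF that] infdist_nonneg[of y G] by linarith
  then show ?thesis
    using in_closed_iff_infdist_zero[OF compact_imp_closed[OF G(2)] G(1)] by blast
qed

lemma sponge_ex1:
  assumes N: "N \<ge> 2" and I: "I \<subseteq> {i. \<forall>j. i $ j < N}" "finite I" "I \<noteq> {}"
    and Q: "\<And>i. i \<in> I \<Longrightarrow> Q i \<in> cube_symmetries"
  shows "\<exists>!F. F \<noteq> {} \<and> compact F \<and> F = sponge_step N I Q F"
proof (rule ex_ex1I)
  let ?A = "sponge_approx N I Q"
  have N1: "N \<ge> 1" using N by simp
  have dec: "?A n \<subseteq> ?A m" if "m \<le> n" for m n
    using that by (rule lift_Suc_antimono_le[rotated])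
      (rule sponge_approx_Suc_subset[OF N1 I(1) Q])
  have cpt: "compact (?A k)" for k
    by (induction k)
      (auto simp: sponge_step_def I(2) intro!: compact_UN compact_continuous_image
        continuous_on_sponge_map Q N1)
  have ne: "?A k \<noteq> {}" for k
    using I(3) by (induction k) (auto simp: sponge_step_def interval_ne_empty_cart)
  define F where "F = (\<Inter>k. ?A k)"
  have "F \<noteq> {}"
    unfolding F_def by (rule compact_nest[OF cpt ne dec])
  moreover have "compact F"
    unfolding F_def by (intro compact_Inter) (auto intro: cpt)
  moreover have "F = sponge_step N I Q F"
  proof
    show "sponge_step N I Q F \<subseteq> F"
    proof -
      have "sponge_step N I Q F \<subseteq> ?A k" for k
      proof -
        have "sponge_step N I Q F \<subseteq> ?A (Suc k)"
          using sponge_step_mono[of F "?A k" N I Q] by (simp add: F_def INT_lower)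
        then show ?thesis using dec[of k "Suc k"] by auto
      qed
      then show ?thesis by (auto simp: F_def)
    qed
    show "F \<subseteq> sponge_step N I Q F"
    proof
      fix x assume x: "x \<in> F"
      have "\<exists>i\<in>I. x \<in> sponge_map N Q i ` ?A k" for k
      proof -
        have "x \<in> ?A (Suc k)" using x unfolding F_def by blast
        then show ?thesis by (auto simp: sponge_step_def)
      qed
      then obtain f where f: "\<And>k. f k \<in> I" "\<And>k. x \<in> sponge_map N Q (f k) ` ?A k" by metis
      have "finite (range f)" using f(1) I(2) by (meson finite_subset image_subsetI)
      then obtain k0 where inf: "infinite {k. f k = f k0}"
        using pigeonhole_infinite[of UNIV f] by auto
      let ?i = "f k0"
      have "x \<in> sponge_map N Q ?i ` ?A k" for k
      proof -
        obtain m where "m \<ge> k" "f m = ?i"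
          using inf by (auto simp: infinite_nat_iff_unbounded_le)
        then show ?thesis using f(2)[of m] dec[of k m] by auto
      qed
      then have "x \<in> (\<Inter>k. sponge_map N Q ?i ` ?A k)" by blast
      also have "\<dots> = sponge_map N Q ?i ` F"
        unfolding F_def
        by (rule image_INT[symmetric, OF inj_sponge_map[where Q=Q, OF Q[OF f(1)] N1]]) auto
      finally show "x \<in> sponge_step N I Q F"
        using f(1) by (auto simp: sponge_step_def)
    qed
  qed
  ultimately show "\<exists>F. F \<noteq> {} \<and> compact F \<and> F = sponge_step N I Q F" by blast
next
  show "F = G" if "F \<noteq> {} \<and> compact F \<and> F = sponge_step N I Q F"
    and "G \<noteq> {} \<and> compact G \<and> G = sponge_step N I Q G" for F G
    using sponge_fixpoint_le[where Q=Q and I=I and F=F and G=G, OF N Q]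
      sponge_fixpoint_le[where Q=Q and I=I and F=G and G=F, OF N Q] that by blast
qed

end

theory Submission
  imports Defs "HOL-Combinatorics.Permutations"
begin

text \<open>
  The relative position of two cubes of a level is an isometry with a signed permutation as
  linear part and an integral translation part, and only finitely many of these make the cubes
  touch: at most \<open>d! 6\<^sup>d\<close>. Whether such a position \<open>h\<close> is realised by touching copies of \<open>F\<^sub>k\<close>,
  i.e. whether \<open>h(F\<^sub>k)\<close> meets \<open>F\<^sub>k\<close>, is determined for \<open>k + 1\<close> by the answers for \<open>k\<close>. The
  decreasing finite sets of realised positions therefore become constant after at most \<open>d! 6\<^sup>d\<close>
  steps, which is less than \<open>C(d)\<close>. From then on adjacency of the pieces \<open>\<phi>\<^sub>i(F\<^sub>k)\<close> no longer
  depends on \<open>k\<close>, so connectedness of one approximation past this level gives that of all.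
\<close>

section \<open>Connectedness of finite unions, and stabilisation of decreasing finite sets\<close>

text \<open>A separation of the \<open>Y\<close>-union leaves each connected \<open>Y i\<close> on
  one side and so splits \<open>I\<close> in two. By \<open>meet\<close>, the corresponding unions
  of the \<open>X i\<close> are disjoint, closed and non-empty, which contradicts
  \<open>conn\<close>.\<close>

lemma connected_Union_transfer:
  fixes X Y :: "'i \<Rightarrow> 'a::topological_space set"
  assumes "finite I" "\<And>i. i \<in> I \<Longrightarrow> closed (X i)" "\<And>i. i \<in> I \<Longrightarrow> X i \<noteq> {}"
    and conn: "connected (\<Union>i\<in>I. X i)"
    and Y: "\<And>i. i \<in> I \<Longrightarrow> connected (Y i)"
    and meet: "\<And>i j. \<lbrakk>i \<in> I; j \<in> I; X i \<inter> X j \<noteq> {}\<rbrakk> \<Longrightarrow> Y i \<inter> Y j \<noteq> {}"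
  shows "connected (\<Union>i\<in>I. Y i)"
proof (rule ccontr)
  assume "\<not> connected (\<Union>i\<in>I. Y i)"
  then obtain U V where UV: "open U" "open V" "(\<Union>i\<in>I. Y i) \<subseteq> U \<union> V"
      "U \<inter> V \<inter> (\<Union>i\<in>I. Y i) = {}" "U \<inter> (\<Union>i\<in>I. Y i) \<noteq> {}" "V \<inter> (\<Union>i\<in>I. Y i) \<noteq> {}"
    unfolding connected_def by auto
  define J where "J = {i\<in>I. Y i \<subseteq> U}"
  define K where "K = {i\<in>I. Y i \<subseteq> V}"
  have split: "Y i \<subseteq> U \<or> Y i \<subseteq> V" if "i \<in> I" for i
  proof -
    have "U \<inter> V \<inter> Y i = {}" "Y i \<subseteq> U \<union> V" using UV(3,4) that by blast+
    then have "U \<inter> Y i = {} \<or> V \<inter> Y i = {}"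
      using connectedD[OF Y[OF that] UV(1,2)] by auto
    then show ?thesis using \<open>Y i \<subseteq> U \<union> V\<close> by blast
  qed
  have JK: "I = J \<union> K" "J \<subseteq> I" "K \<subseteq> I" using split unfolding J_def K_def by auto
  obtain j x where j: "j \<in> I" "x \<in> Y j" "x \<in> U" using UV(5) by blast
  then have "\<not> Y j \<subseteq> V" using UV(4) by blast
  then have "j \<in> J" using split[OF j(1)] j(1) unfolding J_def by simp
  obtain k y where k: "k \<in> I" "y \<in> Y k" "y \<in> V" using UV(6) by blast
  then have "\<not> Y k \<subseteq> U" using UV(4) by blast
  then have "k \<in> K" using split[OF k(1)] k(1) unfolding K_def by simp
  with \<open>j \<in> J\<close> have ne: "(\<Union>i\<in>J. X i) \<noteq> {}" "(\<Union>i\<in>K. X i) \<noteq> {}" using assms(3) JK(2,3) by blast+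
  \<comment> \<open>The case \<open>i = j\<close> is included: as \<open>X i\<close> is non-empty,
    it shows that \<open>J\<close> and \<open>K\<close> share no index.\<close>
  have dis: "X i \<inter> X j = {}" if ij: "i \<in> J" "j \<in> K" for i j
  proof (rule ccontr)
    assume "X i \<inter> X j \<noteq> {}"
    moreover have "i \<in> I" "j \<in> I" using ij JK(2,3) by auto
    ultimately obtain z where "z \<in> Y i" "z \<in> Y j" using meet by blast
    then show False using ij \<open>i \<in> I\<close> UV(4) unfolding J_def K_def by blast
  qed
  have cl: "closed (\<Union>i\<in>J. X i)" "closed (\<Union>i\<in>K. X i)"
    using assms(1,2) JK by (auto intro!: closed_UN finite_subset[OF _ assms(1)])
  have "(\<Union>i\<in>J. X i) \<inter> (\<Union>i\<in>K. X i) \<inter> (\<Union>i\<in>I. X i) = {}"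
    and "(\<Union>i\<in>I. X i) \<subseteq> (\<Union>i\<in>J. X i) \<union> (\<Union>i\<in>K. X i)"
    using dis JK(1) by blast+
  then have "(\<Union>i\<in>J. X i) \<inter> (\<Union>i\<in>I. X i) = {} \<or> (\<Union>i\<in>K. X i) \<inter> (\<Union>i\<in>I. X i) = {}"
    by (rule connected_closedD[OF conn _ _ cl])
  then show False using ne JK(2,3) by blast
qed

text \<open>Every strict inclusion costs an element, so two consecutive terms agree by index
  \<open>card (A 0)\<close> at the latest. As each term determines the next through
  \<open>T\<close>, the sequence is constant from there on.\<close>

lemma decseq_set_stabilizes:
  assumes fin: "finite (A 0)" and dec: "\<And>k. A (Suc k) \<subseteq> A k"
    and step: "\<And>k. A (Suc k) = T (A k)" and k: "k \<ge> card (A 0)"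
  shows "A k = A (card (A 0))"
proof -
  have fin': "finite (A k)" for k
  proof (induction k)
    case (Suc k)
    then show ?case by (rule finite_subset[OF dec])
  qed (rule fin)
  have "\<exists>m\<le>card (A 0). A (Suc m) = A m"
  proof (rule ccontr)
    assume "\<not> ?thesis"
    then have lt: "card (A (Suc m)) < card (A m)" if "m \<le> card (A 0)" for m
      using that psubset_card_mono[OF fin', of "A (Suc m)" m] dec[of m] by blast
    have "card (A m) + m \<le> card (A 0)" if "m \<le> Suc (card (A 0))" for m
      using that
    proof (induction m)
      case (Suc m)
      then show ?case using lt[of m] by simp
    qed simp
    from this[of "Suc (card (A 0))"] show False by simp
  qed
  then obtain m where m: "m \<le> card (A 0)" "A (Suc m) = A m" by blast
  have const: "A n = A m" if "n \<ge> m" for n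
    using that
  proof (induction n rule: dec_induct)
    case IH: (step n)
    have "A (Suc n) = T (A n)" by (rule step)
    also have "\<dots> = A (Suc m)" by (simp only: IH.IH step)
    finally show ?case using m(2) by simp
  qed simp
  show ?thesis using const[OF m(1)] const[OF order_trans[OF m(1) k]] by (rule trans[OF _ sym, rotated])
qed

section \<open>Isometries preserving the integer lattice\<close>

definition grid_map ::
    "('d \<Rightarrow> 'd) \<Rightarrow> ('d \<Rightarrow> int) \<Rightarrow> ('d \<Rightarrow> int) \<Rightarrow> real ^ 'd \<Rightarrow> real ^ 'd"
  where "grid_map p s w x = (\<chi> i. of_int (s i) * x $ p i + of_int (w i))"

lemma grid_map_nth [simp]: "grid_map p s w x $ i = of_int (s i) * x $ p i + of_int (w i)"
  by (simp add: grid_map_def)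

text \<open>This is the symmetry group of the lattice of integer points: signed permutations
  followed by integral translations.\<close>

definition grid_isometries :: "(real ^ 'd \<Rightarrow> real ^ 'd) set"
  where "grid_isometries =
    {grid_map p s w | p s w. p permutes UNIV \<and> (\<forall>i. s i = 1 \<or> s i = -1)}"

lemma grid_isometriesI:
  assumes "p permutes UNIV" "\<And>i. s i = 1 \<or> s i = -1" "\<And>x. f x = grid_map p s w x"
  shows "f \<in> grid_isometries"
proof -
  have "f = grid_map p s w" using assms(3) by blast
  then show ?thesis using assms(1,2) unfolding grid_isometries_def by blast
qed

lemma grid_isometriesE:
  assumes "f \<in> grid_isometries"
  obtains p s w where "p permutes UNIV" "\<And>i. s i = 1 \<or> s i = -1" "f = grid_map p s w"
  using assms unfolding grid_isometries_def by blast

lemma grid_isometries_id: "id \<in> grid_isometries"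
  by (rule grid_isometriesI[of id "\<lambda>_. 1" _ "\<lambda>_. 0"]) (auto simp: vec_eq_iff permutes_id)

lemma grid_isometries_comp:
  assumes "f \<in> grid_isometries" "g \<in> grid_isometries"
  shows "f \<circ> g \<in> grid_isometries"
proof -
  obtain p s v where f: "p permutes UNIV" "\<And>i. s i = 1 \<or> s i = -1" "f = grid_map p s v"
    using assms(1) by (rule grid_isometriesE) blast
  obtain q t w where g: "q permutes UNIV" "\<And>i. t i = 1 \<or> t i = -1" "g = grid_map q t w"
    using assms(2) by (rule grid_isometriesE) blast
  show ?thesis
  proof (rule grid_isometriesI)
    \<comment> \<open>Coordinate \<open>i\<close> of \<open>f y\<close> reads \<open>y\<close> at
      \<open>p i\<close>, so the permutations compose in the order opposite to the maps.\<close>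
    show "q \<circ> p permutes UNIV" using f(1) g(1) by (rule permutes_compose)
    show "s i * t (p i) = 1 \<or> s i * t (p i) = -1" for i
      using f(2)[of i] g(2)[of "p i"] by auto
    show "(f \<circ> g) x = grid_map (q \<circ> p) (\<lambda>i. s i * t (p i)) (\<lambda>i. s i * w (p i) + v i) x" for x
      by (simp add: f(3) g(3) vec_eq_iff algebra_simps)
  qed
qed

lemma grid_isometries_add:
  assumes "f \<in> grid_isometries"
  shows "(\<lambda>x. f x + (\<chi> i. of_int (v i))) \<in> grid_isometries"
proof -
  obtain p s w where f: "p permutes UNIV" "\<And>i. s i = 1 \<or> s i = -1" "f = grid_map p s w"
    using assms by (rule grid_isometriesE) blast
  show ?thesis
    by (rule grid_isometriesI[OF f(1,2), where w="\<lambda>i. w i + v i"])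
      (auto simp: f(3) vec_eq_iff)
qed

text \<open>Conjugating by the scaling with factor \<open>N\<close> keeps the linear part and
  multiplies the translation by \<open>N\<close>, which stays integral.\<close>

lemma grid_isometries_rescale:
  assumes "f \<in> grid_isometries" "N \<noteq> 0"
  shows "(\<lambda>x. real N *\<^sub>R f ((1 / real N) *\<^sub>R x)) \<in> grid_isometries"
proof -
  obtain p s w where f: "p permutes UNIV" "\<And>i. s i = 1 \<or> s i = -1" "f = grid_map p s w"
    using assms(1) by (rule grid_isometriesE) blast
  show ?thesis
    by (rule grid_isometriesI[OF f(1,2), where w="\<lambda>i. int N * w i"])
      (use assms(2) in \<open>auto simp: f(3) vec_eq_iff field_simps\<close>)
qed

lemma grid_isometries_right_inverse:
  assumes "f \<in> grid_isometries"
  obtains g where "g \<in> grid_isometries" "\<And>x. f (g x) = x"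
proof -
  obtain p s w where f: "p permutes UNIV" "\<And>i. s i = 1 \<or> s i = -1" "f = grid_map p s w"
    using assms by (rule grid_isometriesE) blast
  let ?q = "inv p"
  let ?g = "grid_map ?q (\<lambda>j. s (?q j)) (\<lambda>j. - s (?q j) * w (?q j))"
  have "?g \<in> grid_isometries"
    by (rule grid_isometriesI[OF permutes_inv[OF f(1)] f(2)]) simp
  moreover have "f (?g x) = x" for x
  proof -
    have "f (?g x) $ i = x $ i" for i
      using f(2)[of i] by (auto simp: f(3) permutes_inverses[OF f(1)])
    then show ?thesis by (simp add: vec_eq_iff)
  qed
  ultimately show ?thesis using that by blast
qed

section \<open>Symmetries of the cube as signed permutations\<close>

text \<open>The linear part is orthogonal, so its rows and columns are unit vectors. Since the image
  of the cube has width at most 1 in every coordinate, the rows also have l1-norm at most 1. This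
  leaves one entry 1 or -1 in each row, and the columns make the positions a permutation.\<close>

lemma cube_symmetries_subset_grid_isometries:
  "(cube_symmetries :: (real ^ 'd \<Rightarrow> real ^ 'd) set) \<subseteq> grid_isometries"
proof
  fix g :: "real ^ 'd \<Rightarrow> real ^ 'd"
  assume g: "g \<in> cube_symmetries"
  have cube: "0 \<le> g x $ i \<and> g x $ i \<le> 1" if "\<And>j. 0 \<le> x $ j \<and> x $ j \<le> 1" for x i
  proof -
    have "x \<in> unit_cube" using that by (simp add: mem_box_cart)
    then have "g x \<in> unit_cube" using g unfolding cube_symmetries_def by blast
    then show ?thesis by (simp add: mem_box_cart)
  qed
  define f where "f = (\<lambda>x. g x - g 0)"
  have "orthogonal_transformation f"
    using g unfolding orthogonal_transformation_isometry f_def cube_symmetries_def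
    by (simp add: dist_norm)
  then have lin: "linear f" and orth: "orthogonal_matrix (matrix f)"
    by (auto simp: orthogonal_transformation_matrix)
  define a where "a = (\<lambda>i j. matrix f $ i $ j)"
  have g_eq: "g x $ i = (\<Sum>j\<in>UNIV. a i j * x $ j) + g 0 $ i" for x i
  proof -
    have "f x $ i = (\<Sum>j\<in>UNIV. a i j * x $ j)"
      by (subst matrix_vector_mul(2)[OF lin, symmetric])
        (simp add: a_def matrix_vector_mult_def)
    then show ?thesis by (simp add: f_def algebra_simps)
  qed
  have row: "(\<Sum>j\<in>UNIV. (a i j)\<^sup>2) = 1" for i
  proof -
    have "norm (row i (matrix f)) = 1" using orth by (simp add: orthogonal_matrix_orthonormal_rows)
    then show ?thesis by (simp add: norm_vec_def L2_set_def row_def a_def)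
  qed
  have col: "(\<Sum>i\<in>UNIV. (a i j)\<^sup>2) = 1" for j
  proof -
    have "norm (column j (matrix f)) = 1"
      using orth by (simp add: orthogonal_matrix_orthonormal_columns)
    then show ?thesis by (simp add: norm_vec_def L2_set_def column_def a_def)
  qed
  have abs_row: "(\<Sum>j\<in>UNIV. \<bar>a i j\<bar>) \<le> 1" for i
  proof -
    \<comment> \<open>At these opposite vertices coordinate \<open>i\<close> of \<open>g\<close>
      attains its maximum and minimum over the cube; the difference is the l1-norm of row
      \<open>i\<close>.\<close>
    let ?u = "(\<chi> j. if a i j > 0 then 1 else 0) :: real ^ 'd"
    let ?v = "(\<chi> j. if a i j > 0 then 0 else 1) :: real ^ 'd"
    have "(\<Sum>j\<in>UNIV. \<bar>a i j\<bar>) = g ?u $ i - g ?v $ i"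
      unfolding g_eq[of ?u] g_eq[of ?v]
      by (simp add: sum_subtractf[symmetric]) (intro sum.cong; simp)
    also have "\<dots> \<le> 1"
    proof -
      have "g ?u $ i \<le> 1" "0 \<le> g ?v $ i" using cube by simp_all
      then show ?thesis by linarith
    qed
    finally show ?thesis .
  qed
  have abs_le: "\<bar>a i j\<bar> \<le> 1" for i j
    using member_le_sum[of j UNIV "\<lambda>j. \<bar>a i j\<bar>"] abs_row[of i] by simp
  \<comment> \<open>Each row has l1-norm at most 1 but l2-norm equal to 1.\<close>
  have ent: "a i j = 0 \<or> a i j = 1 \<or> a i j = -1" for i j
  proof -
    have nn: "0 \<le> \<bar>a i j\<bar> - (a i j)\<^sup>2" for j
      using abs_le[of i j] mult_left_le[of "\<bar>a i j\<bar>" "\<bar>a i j\<bar>"] by (simp add: power2_eq_square)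
    have "(\<Sum>j\<in>UNIV. \<bar>a i j\<bar> - (a i j)\<^sup>2) \<le> 0"
      using abs_row[of i] row[of i] by (simp add: sum_subtractf)
    then have "(\<Sum>j\<in>UNIV. \<bar>a i j\<bar> - (a i j)\<^sup>2) = 0"
      using sum_nonneg[of UNIV "\<lambda>j. \<bar>a i j\<bar> - (a i j)\<^sup>2"] nn by force
    then have "\<bar>a i j\<bar> - (a i j)\<^sup>2 = 0"
      using nn by (subst (asm) sum_nonneg_eq_0_iff) auto
    then have "\<bar>a i j\<bar> * (1 - \<bar>a i j\<bar>) = 0"
      by (simp only: right_diff_distrib power2_eq_square abs_mult_self_eq mult_1_right)
    then show ?thesis by (auto simp: abs_if split: if_splits)
  qed
  have "\<exists>j. a i j \<noteq> 0" for i
  proof (rule ccontr)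
    assume "\<nexists>j. a i j \<noteq> 0"
    then show False using row[of i] by simp
  qed
  then obtain p where p: "a i (p i) \<noteq> 0" for i by metis
  have p1: "(a i (p i))\<^sup>2 = 1" for i using ent[of i "p i"] p[of i] by auto
  have zero: "a i j = 0" if "j \<noteq> p i" for i j
  proof -
    have "(\<Sum>j\<in>UNIV - {p i}. (a i j)\<^sup>2) = 0"
      using row[of i] p1[of i] by (simp add: sum.remove[of UNIV "p i"])
    then show ?thesis using that by (subst (asm) sum_nonneg_eq_0_iff) auto
  qed
  have "inj p"
  \<comment> \<open>Two rows with their nonzero entry in the same column would give that column
    squared norm at least 2.\<close>
  proof (rule injI, rule ccontr)
    fix i i' assume eq: "p i = p i'" and ne: "i \<noteq> i'"
    have "(\<Sum>k\<in>{i, i'}. (a k (p i))\<^sup>2) \<le> (\<Sum>k\<in>UNIV. (a k (p i))\<^sup>2)"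
      by (rule sum_mono2) auto
    then show False using ne p1[of i] p1[of i'] eq col[of "p i"] by simp
  qed
  then have perm: "p permutes UNIV"
    by (intro bij_imp_permutes) (auto simp: bij_def finite_UNIV_inj_surj)
  have g_p: "g x $ i = a i (p i) * x $ p i + g 0 $ i" for x i
  proof -
    have "(\<Sum>j\<in>UNIV. a i j * x $ j) = a i (p i) * x $ p i"
      using zero by (subst sum.remove[of UNIV "p i"]) auto
    then show ?thesis using g_eq[of x i] by simp
  qed
  define s :: "'d \<Rightarrow> int" where "s = (\<lambda>i. if a i (p i) = 1 then 1 else -1)"
  define w :: "'d \<Rightarrow> int" where "w = (\<lambda>i. if a i (p i) = 1 then 0 else 1)"
  show "g \<in> grid_isometries"
  proof (rule grid_isometriesI[OF perm, of s _ w])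
    show "s i = 1 \<or> s i = -1" for i by (simp add: s_def)
    fix x
    \<comment> \<open>Both \<open>g 0 $ i\<close> and \<open>g 1 $ i = a i (p i) + g 0 $ i\<close>
      lie in the unit interval, which forces the shift 0 for sign 1 and the shift 1 for sign
      -1.\<close>
    have "g 0 $ i = of_int (w i)" "a i (p i) = of_int (s i)" for i
      using cube[of 0 i] cube[of 1 i] g_p[of 1 i] ent[of i "p i"] p[of i]
      by (auto simp: w_def s_def)
    then show "g x = grid_map p s w x"
      by (simp add: vec_eq_iff) (metis g_p)
  qed
qed

section \<open>Counting the positions of touching cubes\<close>

definition cube_contacts :: "(real ^ 'd \<Rightarrow> real ^ 'd) set"
  where "cube_contacts = {h \<in> grid_isometries. \<exists>x\<in>unit_cube. h x \<in> unit_cube}"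

text \<open>There are d! permutations, and each coordinate admits only six pairs of sign and
  shift.\<close>

lemma
  shows finite_cube_contacts: "finite (cube_contacts :: (real ^ 'd \<Rightarrow> real ^ 'd) set)"
    and card_cube_contacts:
      "card (cube_contacts :: (real ^ 'd \<Rightarrow> real ^ 'd) set) \<le> fact CARD('d) * 6 ^ CARD('d)"
proof -
  \<comment> \<open>The image of the unit interval is [w, w + 1] for sign 1 and [w - 1, w] for sign
    -1; it meets the unit interval only for w from -1 to 1, respectively from 0 to 2.\<close>
  define P :: "(int \<times> int) set"
    where "P = {(1, -1), (1, 0), (1, 1), (-1, 0), (-1, 1), (-1, 2)}"
  define D :: "(('d \<Rightarrow> 'd) \<times> ('d \<Rightarrow> int \<times> int)) set"
    where "D = {p. p permutes UNIV} \<times> (\<Pi>\<^sub>E i\<in>UNIV. P)"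
  let ?m = "\<lambda>(p, f). grid_map p (fst \<circ> f) (snd \<circ> f)"
  have sub: "(cube_contacts :: (real ^ 'd \<Rightarrow> real ^ 'd) set) \<subseteq> ?m ` D"
  proof
    fix h :: "real ^ 'd \<Rightarrow> real ^ 'd"
    assume "h \<in> cube_contacts"
    then obtain x where x: "x \<in> unit_cube" "h x \<in> unit_cube" and "h \<in> grid_isometries"
      unfolding cube_contacts_def by blast
    then obtain p s w where f: "p permutes UNIV" "\<And>i. s i = 1 \<or> s i = -1" "h = grid_map p s w"
      by (elim grid_isometriesE) blast
    have "(s i, w i) \<in> P" for i
    proof -
      have b: "0 \<le> x $ p i" "x $ p i \<le> 1" "0 \<le> h x $ i" "h x $ i \<le> 1"
        using x by (auto simp: mem_box_cart)
      show ?thesis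
      proof (cases "s i = 1")
        case True
        then have "-1 \<le> real_of_int (w i)" "real_of_int (w i) \<le> 1"
          using b by (auto simp: f(3))
        then have "-1 \<le> w i" "w i \<le> 1" by linarith+
        then have "w i = -1 \<or> w i = 0 \<or> w i = 1" by presburger
        then show ?thesis using True by (auto simp: P_def)
      next
        case False
        then have s: "s i = -1" using f(2) by blast
        then have "0 \<le> real_of_int (w i)" "real_of_int (w i) \<le> 2"
          using b by (auto simp: f(3))
        then have "0 \<le> w i" "w i \<le> 2" by linarith+
        then have "w i = 0 \<or> w i = 1 \<or> w i = 2" by presburger
        then show ?thesis using s by (auto simp: P_def)
      qed
    qed
    then have "(p, \<lambda>i. (s i, w i)) \<in> D" using f(1) by (auto simp: D_def)
    moreover have "h = ?m (p, \<lambda>i. (s i, w i))" by (simp add: f(3) comp_def)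
    ultimately show "h \<in> ?m ` D" by (rule rev_image_eqI)
  qed
  have finD: "finite D"
    unfolding D_def by (auto simp: P_def intro!: finite_PiE finite_permutations)
  have cardD: "card D = fact CARD('d) * 6 ^ CARD('d)"
  proof -
    have "card P = 6" by (simp add: P_def)
    then show ?thesis
      by (simp add: D_def card_cartesian_product card_permutations card_PiE)
  qed
  show "finite (cube_contacts :: (real ^ 'd \<Rightarrow> real ^ 'd) set)"
    using finite_surj[OF finD sub] .
  show "card (cube_contacts :: (real ^ 'd \<Rightarrow> real ^ 'd) set) \<le> fact CARD('d) * 6 ^ CARD('d)"
    using surj_card_le[OF finD sub] cardD by simp
qed

text \<open>With \<open>K\<close> = d! 2^d the left side is K 3^d \<le> K (K + 1) < (K + 2)^2, and
  for d \<ge> 2 the first summand of C(d) is at least (K + 2)^2. For d = 1 the claim reads 6 <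
  10.\<close>

lemma card_bound_lt_sponge_C:
  assumes "d \<ge> 1"
  shows "fact d * 6 ^ d < sponge_C d"
proof -
  define K where "K = (fact d * 2 ^ d :: nat)"
  have three: "3 ^ d \<le> K + 1"
  proof (cases "d = 1")
    case False
    then have "d \<ge> 2" using assms by simp
    \<comment> \<open>At d = 2 this is the equality 9 = 8 + 1. From there d! 2^d grows by the factor
      2 (n + 1) \<ge> 6, against 3 on the left.\<close>
    then have "3 ^ d \<le> fact d * 2 ^ d + (1::nat)"
    proof (induction d rule: dec_induct)
      case base
      show ?case by (simp add: fact_numeral)
    next
      case (step n)
      let ?M = "fact n * 2 ^ n :: nat"
      have "1 * 1 \<le> ?M" by (intro mult_le_mono) (auto simp: Suc_le_eq)
      moreover have "6 * ?M \<le> fact (Suc n) * 2 ^ Suc n"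
      proof -
        have "6 * ?M \<le> 2 * (n + 1) * ?M" using step(1) by (intro mult_right_mono) auto
        also have "\<dots> = fact (Suc n) * 2 ^ Suc n" by (simp add: algebra_simps)
        finally show ?thesis .
      qed
      moreover have "3 ^ Suc n = 3 * (3 ^ n :: nat)" by simp
      ultimately show ?case using step(3) by linarith
    qed
    then show ?thesis by (simp add: K_def)
  qed (simp add: K_def)
  have "fact d * 6 ^ d = K * 3 ^ d"
    by (simp add: K_def flip: power_mult_distrib)
  also have "\<dots> \<le> K * (K + 1)" using three by (rule mult_left_mono) simp
  finally have le: "fact d * 6 ^ d \<le> K * (K + 1)" .
  show ?thesis
  proof (cases "d = 1")
    case True
    then show ?thesis by (simp add: sponge_C_def sponge_c_def)
  next
    case False
    have "K * (K + 1) < (K + 2)\<^sup>2" by (simp add: power2_eq_square)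
    also have "\<dots> = 1 * (K + 2)\<^sup>2" by simp
    also have "\<dots> \<le> (d - 1) * (K + 2)\<^sup>2" using False assms by (intro mult_right_mono) auto
    also have "\<dots> \<le> sponge_C d" by (simp add: sponge_C_def sponge_c_def K_def)
    finally show ?thesis using le by simp
  qed
qed

section \<open>The sponge as the intersection of its approximations\<close>

locale sponge_system =
  fixes N :: nat
    and I :: "(nat ^ 'd) set"
    and Q :: "nat ^ 'd \<Rightarrow> real ^ 'd \<Rightarrow> real ^ 'd"
  assumes N: "N \<ge> 2"
    and digits: "I \<subseteq> {i. \<forall>j. i $ j < N}"
    and finite_I: "finite I" and I_nonempty: "I \<noteq> {}"
    and symmetries: "\<And>i. i \<in> I \<Longrightarrow> Q i \<in> cube_symmetries"
begin

abbreviation \<phi> where "\<phi> \<equiv> sponge_map N Q"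
abbreviation approx where "approx \<equiv> sponge_approx N I Q"
abbreviation S where "S \<equiv> sponge N I Q"

lemma approx_antimono: "m \<le> n \<Longrightarrow> approx n \<subseteq> approx m"
  by (rule lift_Suc_antimono_le) (use sponge_approx_Suc_subset[OF _ digits symmetries] N in auto)

lemma approx_subset_cube: "approx k \<subseteq> unit_cube"
  using approx_antimono[of 0 k] by simp

lemma compact_image: "i \<in> I \<Longrightarrow> compact A \<Longrightarrow> compact (\<phi> i ` A)"
  by (intro compact_continuous_image continuous_on_sponge_map symmetries) (use N in auto)

lemma connected_image: "i \<in> I \<Longrightarrow> connected A \<Longrightarrow> connected (\<phi> i ` A)"
  by (intro connected_continuous_image continuous_on_sponge_map symmetries) (use N in auto)

lemma compact_approx: "compact (approx k)"
  by (induction k) (auto simp: sponge_step_def finite_I intro!: compact_UN compact_image)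

lemma approx_nonempty: "approx k \<noteq> {}"
  using I_nonempty by (induction k) (auto simp: sponge_step_def interval_ne_empty_cart)

lemma sponge_nonempty: "S \<noteq> {}" and compact_sponge: "compact S"
  and sponge_fixpoint: "S = sponge_step N I Q S"
  using theI'[OF sponge_ex1[OF N digits finite_I I_nonempty symmetries]]
  unfolding sponge_def[symmetric] by auto

text \<open>The map that produces \<open>x\<close> from a point of \<open>A\<close> also carries
  along a nearest point of \<open>B\<close>, and it divides distances by \<open>N\<close>.\<close>

lemma infdist_step:
  assumes B: "compact B" "B \<noteq> {}" and A: "\<And>x. x \<in> A \<Longrightarrow> infdist x B \<le> D"
    and x: "x \<in> sponge_step N I Q A"
  shows "infdist x (sponge_step N I Q B) \<le> D / real N"
proof -
  obtain i y where i: "i \<in> I" and y: "y \<in> A" "x = \<phi> i y"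
    using x unfolding sponge_step_def by blast
  obtain z where z: "z \<in> B" "infdist y B = dist y z"
    using infdist_attains_inf[OF compact_imp_closed[OF B(1)] B(2)] by metis
  have "\<phi> i z \<in> sponge_step N I Q B" using i z(1) unfolding sponge_step_def by blast
  then have "infdist x (sponge_step N I Q B) \<le> dist x (\<phi> i z)" by (rule infdist_le)
  also have "\<dots> = infdist y B / real N"
    using dist_sponge_map[where Q=Q and i=i, OF symmetries[OF i]] y(2) z(2) by metis
  also have "\<dots> \<le> D / real N" using A[OF y(1)] N by (simp add: divide_right_mono)
  finally show ?thesis .
qed

lemma infdist_le_all_powers_imp_0:
  assumes "\<And>k. infdist x A \<le> D / real N ^ k"
  shows "infdist x A = 0"
proof -
  have "(\<lambda>k. D / real N ^ k) \<longlonglongrightarrow> 0"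
    using N by (intro LIMSEQ_divide_realpow_zero) auto
  then have "infdist x A \<le> 0" by (rule LIMSEQ_le_const) (use assms in auto)
  then show ?thesis using infdist_nonneg[of x A] by linarith
qed

lemma compact_infdist_bound:
  assumes "compact A"
  obtains D where "\<And>x. x \<in> A \<Longrightarrow> infdist x B \<le> D"
proof -
  have "bdd_above ((\<lambda>x. infdist x B) ` A)"
    by (intro bounded_imp_bdd_above compact_imp_bounded compact_continuous_image assms
        continuous_on_infdist continuous_on_id)
  then show ?thesis using that unfolding bdd_above_def by auto
qed

text \<open>Comparing \<open>S\<close> with the approximations, both iterated by the same
  contraction, puts \<open>S\<close> within D / N^k of \<open>approx k\<close> and hence of the
  larger cube, for every k. So \<open>S\<close> lies in the cube, and monotonicity of the step
  propagates the inclusion to all levels.\<close>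

lemma sponge_subset_approx: "S \<subseteq> approx k"
proof (induction k)
  case 0
  obtain D where D: "\<And>x. x \<in> S \<Longrightarrow> infdist x (approx 0) \<le> D"
    using compact_infdist_bound[OF compact_sponge] by blast
  have "infdist x (approx k) \<le> D / real N ^ k" if "x \<in> S" for k x
    using that
  proof (induction k arbitrary: x)
    case (Suc k)
    have "x \<in> sponge_step N I Q S" using Suc.prems sponge_fixpoint by blast
    then show ?case
      using infdist_step[OF compact_approx approx_nonempty Suc.IH] by (simp add: mult.commute)
  qed (use D in simp)
  moreover have "infdist x (approx 0) \<le> infdist x (approx k)" for x k
    by (rule infdist_mono[OF approx_antimono approx_nonempty]) simp
  ultimately have "infdist x (approx 0) \<le> D / real N ^ k" if "x \<in> S" for k x
    using that order_trans by blast
  then have "infdist x (approx 0) = 0" if "x \<in> S" for x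
    using infdist_le_all_powers_imp_0 that by blast
  then show ?case
    using in_closed_iff_infdist_zero[OF compact_imp_closed[OF compact_approx] approx_nonempty]
    by blast
next
  case (Suc k)
  have "sponge_step N I Q S \<subseteq> approx (Suc k)"
    using sponge_step_mono[OF Suc] by simp
  then show ?case unfolding sponge_fixpoint[symmetric] .
qed

text \<open>For the reverse inclusion the contraction is used with the roles exchanged: points of
  \<open>approx k\<close> are within D / N^k of the closed set \<open>S\<close>.\<close>

lemma sponge_eq_Inter: "S = (\<Inter>k. approx k)"
proof
  show "S \<subseteq> (\<Inter>k. approx k)" using sponge_subset_approx by blast
  obtain D where D: "\<And>x. x \<in> approx 0 \<Longrightarrow> infdist x S \<le> D"
    using compact_infdist_bound[OF compact_approx] by blast
  have *: "infdist x S \<le> D / real N ^ k" if "x \<in> approx k" for k x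
    using that
  proof (induction k arbitrary: x)
    case (Suc k)
    have "infdist x (sponge_step N I Q S) \<le> D / real N ^ k / real N"
      by (rule infdist_step[OF compact_sponge sponge_nonempty Suc.IH]) (use Suc.prems in auto)
    then show ?case unfolding sponge_fixpoint[symmetric] by (simp add: mult.commute)
  qed (use D in simp)
  show "(\<Inter>k. approx k) \<subseteq> S"
  proof
    fix x assume "x \<in> (\<Inter>k. approx k)"
    then have "infdist x S = 0" using * by (intro infdist_le_all_powers_imp_0) blast
    then show "x \<in> S"
      using in_closed_iff_infdist_zero[OF compact_imp_closed[OF compact_sponge] sponge_nonempty]
      by blast
  qed
qed

section \<open>Relative positions realised at each level\<close>

text \<open>The map sought is \<open>h\<close> seen from inside the pieces: first
  \<open>\<phi> b\<close>, then \<open>h\<close>, then the inverse of \<open>\<phi> a\<close>. The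
  factors 1/N and N cancel, so the translation part remains integral.\<close>

lemma grid_isometries_conjugate:
  assumes h: "h \<in> grid_isometries" and a: "a \<in> I" and b: "b \<in> I"
  obtains h' where "h' \<in> grid_isometries" "\<And>x. \<phi> a (h' x) = h (\<phi> b x)"
proof -
  have Q: "Q a \<in> grid_isometries" "Q b \<in> grid_isometries"
    using cube_symmetries_subset_grid_isometries symmetries a b by auto
  obtain g where g: "g \<in> grid_isometries" "\<And>x. Q a (g x) = x"
    using grid_isometries_right_inverse[OF Q(1)] by blast
  \<comment> \<open>Here \<open>r1\<close> is \<open>\<phi> b\<close> without its factor 1/N,
    \<open>r2\<close> is \<open>h\<close> rescaled by \<open>N\<close>, and \<open>r3\<close> with
    \<open>g\<close> undoes the digit and the symmetry of \<open>\<phi> a\<close>.\<close>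
  define r1 where "r1 = (\<lambda>x. Q b x + (\<chi> j. of_int (int (b $ j))))"
  define r2 where "r2 = (\<lambda>x. real N *\<^sub>R h ((1 / real N) *\<^sub>R x))"
  define r3 where "r3 = (\<lambda>x. id x + (\<chi> j. of_int (- int (a $ j))) :: real ^ 'd)"
  have "g \<circ> r3 \<circ> r2 \<circ> r1 \<in> grid_isometries"
    unfolding r1_def r2_def r3_def
    by (intro grid_isometries_comp grid_isometries_add grid_isometries_rescale
        grid_isometries_id g Q h) (use N in simp)
  moreover have "\<phi> a ((g \<circ> r3 \<circ> r2 \<circ> r1) x) = h (\<phi> b x)" for x
  proof -
    have "r3 y + (\<chi> j. real (a $ j)) = y" for y
      by (simp add: r3_def vec_eq_iff)
    then have "\<phi> a ((g \<circ> r3 \<circ> r2 \<circ> r1) x) = (1 / real N) *\<^sub>R r2 (r1 x)"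
      by (simp add: sponge_map_def g(2))
    also have "\<dots> = h (\<phi> b x)" using N by (simp add: r2_def r1_def sponge_map_def)
    finally show ?thesis .
  qed
  ultimately show ?thesis using that by blast
qed

definition contacts :: "nat \<Rightarrow> (real ^ 'd \<Rightarrow> real ^ 'd) set"
  where "contacts k = {h \<in> grid_isometries. \<exists>x\<in>approx k. h x \<in> approx k}"

text \<open>The level k does not occur: the next set of contacts depends on the current one alone,
  as stabilisation requires.\<close>

definition contact_step :: "(real ^ 'd \<Rightarrow> real ^ 'd) set \<Rightarrow> (real ^ 'd \<Rightarrow> real ^ 'd) set"
  where "contact_step H =
    {h \<in> grid_isometries. \<exists>a\<in>I. \<exists>b\<in>I. \<exists>h'\<in>H. \<forall>x. \<phi> a (h' x) = h (\<phi> b x)}"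

lemma inj_phi: "i \<in> I \<Longrightarrow> inj (\<phi> i)"
  by (rule inj_sponge_map[OF symmetries]) (use N in auto)

lemma contacts_0: "contacts 0 = cube_contacts"
  by (simp add: contacts_def cube_contacts_def)

text \<open>A contact point at level k + 1 lies in some piece \<open>b\<close>, and its image under
  \<open>h\<close> in some piece \<open>a\<close>. Pulling both back turns \<open>h\<close> into a
  contact \<open>h'\<close> at level k, and pushing forward reverses this.\<close>

lemma contacts_Suc: "contacts (Suc k) = contact_step (contacts k)"
proof
  show "contacts (Suc k) \<subseteq> contact_step (contacts k)"
  proof
    fix h assume "h \<in> contacts (Suc k)"
    then obtain x where h: "h \<in> grid_isometries" and x: "x \<in> approx (Suc k)" "h x \<in> approx (Suc k)"
      unfolding contacts_def by blast
    obtain b y where b: "b \<in> I" "y \<in> approx k" "x = \<phi> b y"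
      using x(1) by (auto simp: sponge_step_def)
    obtain a z where a: "a \<in> I" "z \<in> approx k" "h x = \<phi> a z"
      using x(2) by (auto simp: sponge_step_def)
    obtain h' where h': "h' \<in> grid_isometries" "\<And>x. \<phi> a (h' x) = h (\<phi> b x)"
      using grid_isometries_conjugate[OF h a(1) b(1)] by blast
    have "h' y = z" using h'(2)[of y] a(3) b(3) inj_phi[OF a(1)] by (simp add: inj_eq)
    then have "h' \<in> contacts k" using h'(1) a(2) b(2) unfolding contacts_def by blast
    then show "h \<in> contact_step (contacts k)"
      using h h'(2) a(1) b(1) unfolding contact_step_def by blast
  qed
  show "contact_step (contacts k) \<subseteq> contacts (Suc k)"
  proof
    fix h assume "h \<in> contact_step (contacts k)"
    then obtain a b h' where h: "h \<in> grid_isometries" and ab: "a \<in> I" "b \<in> I"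
        and h': "h' \<in> contacts k" "\<And>x. \<phi> a (h' x) = h (\<phi> b x)"
      unfolding contact_step_def by blast
    obtain x where x: "x \<in> approx k" "h' x \<in> approx k" using h'(1) unfolding contacts_def by blast
    have "\<phi> b x \<in> approx (Suc k)" "\<phi> a (h' x) \<in> approx (Suc k)"
      using x ab by (auto simp: sponge_step_def)
    then show "h \<in> contacts (Suc k)" using h h'(2)[of x] unfolding contacts_def by auto
  qed
qed

lemma contacts_antimono: "m \<le> n \<Longrightarrow> contacts n \<subseteq> contacts m"
  using approx_antimono[of m n] unfolding contacts_def by blast

text \<open>Levels up to \<open>m\<close> are covered by monotonicity, later ones because the
  sequence is already constant at \<open>m\<close>.\<close>

lemma contacts_stable:
  assumes "m \<ge> card (cube_contacts :: (real ^ 'd \<Rightarrow> real ^ 'd) set)"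
  shows "contacts m \<subseteq> contacts k"
proof (cases "k \<le> m")
  case True
  then show ?thesis by (rule contacts_antimono)
next
  case False
  have "contacts n = contacts (card (contacts 0))" if "n \<ge> card (contacts 0)" for n
    by (rule decseq_set_stabilizes[of contacts contact_step, OF _ contacts_antimono contacts_Suc that])
      (simp_all add: contacts_0 finite_cube_contacts)
  from this[of k] this[of m] show ?thesis using False assms by (simp add: contacts_0)
qed

text \<open>Here \<open>h\<close> is the position of piece \<open>j\<close> as seen from piece
  \<open>i\<close>. It does not depend on k, so adjacency at every level is a question about the
  same \<open>h\<close>.\<close>

lemma pieces_meet_iff:
  assumes ij: "i \<in> I" "j \<in> I"
    and h: "h \<in> grid_isometries" "\<And>x. \<phi> i (h x) = \<phi> j x"
  shows "\<phi> i ` approx k \<inter> \<phi> j ` approx k \<noteq> {} \<longleftrightarrow> h \<in> contacts k"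
proof -
  have "\<phi> i y = \<phi> j x \<longleftrightarrow> y = h x" for x y
    using inj_phi[OF ij(1)] unfolding h(2)[symmetric] by (simp add: inj_eq)
  then show ?thesis using h(1) unfolding contacts_def by (auto; metis IntI empty_iff imageI)
qed

lemma pieces_meet_stable:
  assumes "m \<ge> card (cube_contacts :: (real ^ 'd \<Rightarrow> real ^ 'd) set)"
    and ij: "i \<in> I" "j \<in> I" and meet: "\<phi> i ` approx m \<inter> \<phi> j ` approx m \<noteq> {}"
  shows "\<phi> i ` approx k \<inter> \<phi> j ` approx k \<noteq> {}"
proof -
  obtain h where h: "h \<in> grid_isometries" "\<And>x. \<phi> i (h x) = \<phi> j x"
    using grid_isometries_conjugate[OF grid_isometries_id ij] by auto
  show ?thesis
    using pieces_meet_iff[OF ij h] meet contacts_stable[OF assms(1)] by blast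
qed

section \<open>Connectedness of the approximations and of the sponge\<close>

text \<open>The set \<open>X\<close> is a model whose pieces have a connected union and adjacencies
  shared by level k. It is taken to be \<open>S\<close> in one direction of the equivalence and
  \<open>approx m\<close> in the other.\<close>

lemma connected_approx_Suc:
  assumes X: "compact X" "X \<noteq> {}" "connected (sponge_step N I Q X)"
    and meet: "\<And>i j. \<lbrakk>i \<in> I; j \<in> I; \<phi> i ` X \<inter> \<phi> j ` X \<noteq> {}\<rbrakk> \<Longrightarrow>
      \<phi> i ` approx k \<inter> \<phi> j ` approx k \<noteq> {}"
    and "connected (approx k)"
  shows "connected (approx (Suc k))"
  unfolding sponge_approx.simps sponge_step_def
  by (rule connected_Union_transfer[OF finite_I, of "\<lambda>i. \<phi> i ` X"])
    (use assms in \<open>auto simp: sponge_step_def[symmetric] intro!: compact_imp_closed compact_image connected_image\<close>)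

lemma connected_cube: "connected (approx 0)"
  by (simp add: convex_connected)

text \<open>Both directions show by induction from the cube that all approximations are connected.
  Adjacencies of the pieces of \<open>S\<close> persist since \<open>S\<close> lies in every
  \<open>approx k\<close>, those of the pieces of \<open>approx m\<close> by stabilisation. Finally,
  a nested intersection of compact connected sets is connected.\<close>

theorem connected_sponge_iff:
  assumes m: "m \<ge> card (cube_contacts :: (real ^ 'd \<Rightarrow> real ^ 'd) set)"
  shows "connected S \<longleftrightarrow> connected (approx (Suc m))"
proof
  assume S: "connected S"
  have "connected (approx k)" for k
  proof (induction k)
    case (Suc k)
    have "\<phi> i ` approx k \<inter> \<phi> j ` approx k \<noteq> {}" if "\<phi> i ` S \<inter> \<phi> j ` S \<noteq> {}" for i j
      using that sponge_subset_approx[of k] by blast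
    then show ?case
      using S sponge_fixpoint
      by (intro connected_approx_Suc[OF compact_sponge sponge_nonempty _ _ Suc]) auto
  qed (rule connected_cube)
  then show "connected (approx (Suc m))" .
next
  assume "connected (approx (Suc m))"
  then have step: "connected (sponge_step N I Q (approx m))" by simp
  have "connected (approx k)" for k
  proof (induction k)
    case (Suc k)
    show ?case
      by (rule connected_approx_Suc[OF compact_approx approx_nonempty step
            pieces_meet_stable[OF m] Suc])
  qed (rule connected_cube)
  then show "connected S"
    unfolding sponge_eq_Inter by (intro connected_nest compact_approx approx_antimono)
qed

end

theorem theorem1p7:
  fixes N :: nat
    and I :: "(nat ^ 'd) set"
    and Q :: "nat ^ 'd \<Rightarrow> real ^ 'd \<Rightarrow> real ^ 'd"
  assumes "N \<ge> 2"
    and "I \<subseteq> {i. \<forall>j. i $ j < N}"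
    and "1 < card I" and "card I < N ^ CARD('d)"
    and "\<And>i. i \<in> I \<Longrightarrow> Q i \<in> cube_symmetries"
  shows "connected (sponge N I Q) \<longleftrightarrow> connected (sponge_approx N I Q (sponge_C CARD('d)))"
proof -
  \<comment> \<open>Finiteness of \<open>I\<close> follows from \<open>1 < card I\<close>, as
    infinite sets have \<open>card\<close> 0.\<close>
  interpret sponge_system N I Q
    by unfold_locales (use assms card.infinite in force)+
  \<comment> \<open>The inequality must be strict: the criterion is applied with m = C(d) - 1, whose
    successor is C(d).\<close>
  have "card (cube_contacts :: (real ^ 'd \<Rightarrow> real ^ 'd) set) < sponge_C CARD('d)"
    by (rule le_less_trans[OF card_cube_contacts card_bound_lt_sponge_C]) (simp add: Suc_le_eq)
  then show ?thesis
    using connected_sponge_iff[of "sponge_C CARD('d) - 1"] by simp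
qed

end
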